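(* Let $\Omega\subset\mathbb{C}$ be a simply connected domain and let $f=h\overline g$ be a sense-preserving locally univalent logharmonic mapping defined in $\Omega$ with dilatation $\omega$ and such that $P_f=0$ in $\Omega$. Then there are complex numbers $a$, $b$ and $k$ with $\operatorname{Re}\{k\}>1/2$ such that, for all $z\in\Omega$, $$h(z)=(az+b)^k\quad\text{and}\quad \omega(z)=\frac{1-k}{k}.$$
   Context: A sense-preserving locally univalent logharmonic mapping $f=h\overline{g}$ on a domain: $h,g$ are analytic there, $h'$ does not vanish, $g$ does not vanish, and the (second complex) dilatation $\omega=\dfrac{g'h}{gh'}$ satisfies $|\omega|<1$ everywhere. Its pre-Schwarzian derivative is $$P_f=\frac{h''}{h'}+\omega\frac{h'}{h}-\frac{\omega'\overline{\omega}}{1-|\omega|^2},$$ where $\omega\, h'/h=g'/g$ (and the term is understood as $g'/g$ at a zero of $h$). The power $(az+b)^k$ is understood as a holomorphic branch on $\Omega$: if $k=1$ it is $az+b$ itself; if $k\neq1$, then $az+b$ is non-vanishing on $\Omega$ and $(az+b)^k=e^{k\ell(z)}$ for some holomorphic $\ell$ on $\Omega$ with $e^{\ell(z)}=az+b$. *)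

theory Defs
  imports "HOL-Complex_Analysis.Complex_Analysis"
begin

definition complex_domain :: "complex set \<Rightarrow> bool" where
  "complex_domain \<Omega> \<longleftrightarrow> open \<Omega> \<and> connected \<Omega> \<and> \<Omega> \<noteq> {}"

text \<open>
  The factors \<open>h\<close> and \<open>g\<close> of a logharmonic mapping \<open>f = h * cnj g\<close> are determined by \<open>f\<close> only
  up to constants \<open>(h, g) \<mapsto> (c * h, g / cnj c)\<close>, so the notions below refer to a given pair;
  the dilatation and the pre-Schwarzian derivative do not depend on the choice of that pair.
\<close>

definition dilatation :: "(complex \<Rightarrow> complex) \<Rightarrow> (complex \<Rightarrow> complex) \<Rightarrow> complex \<Rightarrow> complex" where
  "dilatation h g z = (deriv g z * h z) / (g z * deriv h z)"

definition sp_loc_univ_logharmonic ::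
  "complex set \<Rightarrow> (complex \<Rightarrow> complex) \<Rightarrow> (complex \<Rightarrow> complex) \<Rightarrow> (complex \<Rightarrow> complex) \<Rightarrow> bool" where
  "sp_loc_univ_logharmonic \<Omega> f h g \<longleftrightarrow>
     h holomorphic_on \<Omega> \<and> g holomorphic_on \<Omega> \<and>
     (\<forall>z\<in>\<Omega>. f z = h z * cnj (g z)) \<and>
     (\<forall>z\<in>\<Omega>. deriv h z \<noteq> 0) \<and> (\<forall>z\<in>\<Omega>. g z \<noteq> 0) \<and>
     (\<forall>z\<in>\<Omega>. cmod (dilatation h g z) < 1)"

text \<open>
  Off the zeros of \<open>h\<close> the middle term equals \<open>g' / g\<close>; at a zero of \<open>h\<close>, where the quotient
  would be \<open>0\<close> by the convention \<open>x / 0 = 0\<close>, it is set to that value explicitly.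
\<close>

definition pre_Schwarzian :: "(complex \<Rightarrow> complex) \<Rightarrow> (complex \<Rightarrow> complex) \<Rightarrow> complex \<Rightarrow> complex" where
  "pre_Schwarzian h g z =
     deriv (deriv h) z / deriv h z
     + (if h z = 0 then deriv g z / g z else dilatation h g z * (deriv h z / h z))
     - deriv (dilatation h g) z * cnj (dilatation h g z)
       / (1 - of_real ((cmod (dilatation h g z))\<^sup>2))"

text \<open>
  \<open>is_affine_power \<Omega> a b k p\<close>: on \<open>\<Omega>\<close>, \<open>p\<close> is a holomorphic branch of \<open>(a * z + b)\<^sup>k\<close>.
  The principal power \<open>powr\<close> is not suitable here, since it jumps across the negative real axis.
\<close>

definition is_affine_power ::
  "complex set \<Rightarrow> complex \<Rightarrow> complex \<Rightarrow> complex \<Rightarrow> (complex \<Rightarrow> complex) \<Rightarrow> bool" where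
  "is_affine_power \<Omega> a b k p \<longleftrightarrow>
     (if k = 1 then \<forall>z\<in>\<Omega>. p z = a * z + b
      else (\<forall>z\<in>\<Omega>. a * z + b \<noteq> 0) \<and>
           (\<exists>l. l holomorphic_on \<Omega> \<and> (\<forall>z\<in>\<Omega>. exp (l z) = a * z + b) \<and>
                (\<forall>z\<in>\<Omega>. p z = exp (k * l z))))"

end

theory Submission
  imports Defs
begin

text \<open>
  Put \<open>\<phi> = h'' / h' + g' / g\<close>, which is holomorphic. The equation \<open>P\<^sub>f = 0\<close> reads
  \<open>\<phi> = cnj \<omega> * (\<omega>' + \<phi> * \<omega>)\<close>. Where \<open>\<omega>' + \<phi> * \<omega>\<close> does not vanish, \<open>cnj \<omega>\<close> is therefore
  holomorphic along with \<open>\<omega>\<close>, which forces \<open>\<omega>' = 0\<close>; where it vanishes, so does \<open>\<phi>\<close>, and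
  again \<open>\<omega>' = 0\<close>. Hence \<open>\<omega>\<close> is a constant \<open>c\<close> and \<open>\<phi> = 0\<close>, which gives
  \<open>h * h'' + c * h'\<^sup>2 = 0\<close>. For \<open>c = 0\<close> this makes \<open>h\<close> affine; otherwise \<open>h\<close> has no zeros and
  \<open>h\<^bsup>1 + c\<^esup>\<close> has constant derivative. The exponent is \<open>k = 1 / (1 + c)\<close>.
\<close>

text \<open>The real derivative of \<open>cnj f\<close> is the antilinear map
  \<open>x \<mapsto> cnj (D * x)\<close>. If it is also multiplication by \<open>E\<close>, the
  values at 1 and \<open>\<i>\<close> give \<open>E = cnj D\<close> and
  \<open>E = - cnj D\<close>.\<close>

lemma deriv_zero_if_cnj_field_differentiable:
  assumes "(f has_field_derivative D) (at z)"
    and "((\<lambda>x. cnj (f x)) has_field_derivative E) (at z)"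
  shows "D = 0"
proof -
  have "((\<lambda>x. cnj (f x)) has_derivative (\<lambda>x. cnj (D * x))) (at z)"
    using has_derivative_compose[OF assms(1)[unfolded has_field_derivative_def]
        bounded_linear.has_derivative[OF bounded_linear_cnj has_derivative_ident]]
    by simp
  then have "(\<lambda>x. cnj (D * x)) = (*) E"
    using assms(2) unfolding has_field_derivative_def by (rule has_derivative_unique)
  then have "cnj D = E" "cnj D * cnj \<i> = E * \<i>"
    by (metis complex_cnj_mult mult.right_neutral complex_cnj_one)+
  then show "D = 0" by auto
qed

lemma affine_if_deriv_constant:
  fixes F :: "complex \<Rightarrow> complex"
  assumes "open S" "connected S"
    and "\<And>z. z \<in> S \<Longrightarrow> (F has_field_derivative a) (at z)"
  obtains b where "\<And>z. z \<in> S \<Longrightarrow> F z = a * z + b"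
proof -
  have "((\<lambda>z. F z - a * z) has_field_derivative 0) (at z)" if "z \<in> S" for z
    by (rule derivative_eq_intros assms(3) that refl | simp)+
  then have "(\<lambda>z. F z - a * z) constant_on S"
    using assms(1,2) by (intro has_field_derivative_0_imp_constant_on)
  then obtain b where "\<And>z. z \<in> S \<Longrightarrow> F z - a * z = b"
    unfolding constant_on_def by blast
  then have "F z = a * z + b" if "z \<in> S" for z
    using that by (metis add.commute diff_add_cancel)
  then show thesis using that by blast
qed

lemma constant_if_conjugate_relation:
  fixes w p :: "complex \<Rightarrow> complex"
  assumes S: "open S" "connected S"
    and w: "w holomorphic_on S" and p: "p holomorphic_on S"
    and less1: "\<And>z. z \<in> S \<Longrightarrow> cmod (w z) < 1"
    and rel: "\<And>z. z \<in> S \<Longrightarrow> p z = deriv w z * cnj (w z) / (1 - of_real ((cmod (w z))\<^sup>2))"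
  shows "w constant_on S" and "\<And>z. z \<in> S \<Longrightarrow> p z = 0"
proof -
  define q where "q z = deriv w z + p z * w z" for z
  have q: "q holomorphic_on S"
    unfolding q_def by (intro holomorphic_intros w p S)
  have nz: "1 - of_real ((cmod (w z))\<^sup>2) \<noteq> (0::complex)" if "z \<in> S" for z
  proof -
    have "(cmod (w z))\<^sup>2 \<noteq> 1"
      using less1[OF that] norm_ge_zero[of "w z"] unfolding power2_eq_1_iff by linarith
    then show ?thesis by (metis of_real_1 of_real_eq_iff right_minus_eq)
  qed
  have key: "p z = cnj (w z) * q z" if "z \<in> S" for z
  proof -
    \<comment> \<open>The denominator is cleared with \<open>|w|^2 = w * cnj w\<close>; moving the
      term with \<open>p\<close> to the right then makes \<open>cnj w\<close> a common factor, and
      the cofactor \<open>q\<close> is holomorphic.\<close>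
    have "p z * (1 - w z * cnj (w z)) = deriv w z * cnj (w z)"
      using rel[OF that] nz[OF that] by (simp add: complex_norm_square del: of_real_power)
    then show ?thesis unfolding q_def by (simp add: algebra_simps)
  qed
  have dw: "deriv w z = 0" if z: "z \<in> S" for z
  proof (cases "q z = 0")
    case True
    with key[OF z] have "p z = 0" by simp
    with True show ?thesis by (simp add: q_def)
  next
    case False
    \<comment> \<open>On this neighbourhood of \<open>z\<close> one may divide by \<open>q\<close>,
      so that \<open>cnj w = p / q\<close> is holomorphic there.\<close>
    have "open (S \<inter> q -` (- {0}))"
      using continuous_open_preimage[OF holomorphic_on_imp_continuous_on[OF q] S(1)]
      by (simp add: open_Compl)
    moreover define U where "U = S \<inter> q -` (- {0})"
    ultimately have U: "open U" "z \<in> U" "U \<subseteq> S"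
      using z False by auto
    have "(\<lambda>x. p x / q x) holomorphic_on U"
      using p q by (intro holomorphic_intros) (auto simp: U_def elim: holomorphic_on_subset)
    then have "(\<lambda>x. cnj (w x)) holomorphic_on U"
      by (rule holomorphic_transform) (auto simp: U_def key)
    then have "((\<lambda>x. cnj (w x)) has_field_derivative deriv (\<lambda>x. cnj (w x)) z) (at z)"
      using U by (intro holomorphic_derivI)
    with holomorphic_derivI[OF w S(1) z] show ?thesis
      by (rule deriv_zero_if_cnj_field_differentiable)
  qed
  show "w constant_on S"
  proof (rule has_field_derivative_0_imp_constant_on)
    show "(w has_field_derivative 0) (at z)" if "z \<in> S" for z
      using holomorphic_derivI[OF w S(1) that] dw[OF that] by simp
  qed (use S in auto)
  show "p z = 0" if "z \<in> S" for z
    using rel[OF that] dw[OF that] by simp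
qed

text \<open>Since \<open>Re (1 / (1 + c)) = (1 + Re c) / |1 + c|^2\<close>, the bound amounts to
  \<open>|1 + c|^2 < 2 + 2 * Re c\<close>, that is, to \<open>|c|^2 < 1\<close>.\<close>

lemma Re_inverse_gt_half:
  assumes "cmod c < 1"
  shows "Re (1 / (1 + c)) > 1 / 2"
proof -
  have "(Re c)\<^sup>2 + (Im c)\<^sup>2 < 1"
    using assms by (simp add: cmod_def)
  moreover have "1 + c \<noteq> 0"
    using assms by (metis add_eq_0_iff less_irrefl norm_minus_cancel norm_one)
  then have "(1 + Re c)\<^sup>2 + (Im c)\<^sup>2 > 0"
    by (simp add: complex_eq_iff sum_power2_gt_zero_iff)
  ultimately show ?thesis
    by (simp add: Re_divide field_simps power2_eq_square)
qed

lemma affine_if_mult_second_deriv_zero: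
  assumes S: "open S" "connected S" and h: "h holomorphic_on S"
    and dh: "\<And>z. z \<in> S \<Longrightarrow> deriv h z \<noteq> 0"
    and eq: "\<And>z. z \<in> S \<Longrightarrow> h z * deriv (deriv h) z = 0"
  obtains a b where "\<And>z. z \<in> S \<Longrightarrow> h z = a * z + b"
proof -
  have h': "deriv h holomorphic_on S" "deriv (deriv h) holomorphic_on S"
    using h S(1) by (auto intro!: holomorphic_deriv)
  have "deriv (deriv h) z = 0" if z: "z \<in> S" for z
  proof (cases "h z = 0")
    case False
    with eq[OF z] show ?thesis by simp
  next
    case True
    \<comment> \<open>Differentiating \<open>h * h'' = 0\<close> gives
      \<open>h * h''' + h' * h'' = 0\<close>; at a zero of \<open>h\<close> only
      \<open>h' * h''\<close> survives, and \<open>h'\<close> is nonzero.\<close>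
    have "((\<lambda>x. h x * deriv (deriv h) x) has_field_derivative
        (h z * deriv (deriv (deriv h)) z + deriv h z * deriv (deriv h) z)) (at z)"
      using h h' S(1) z by (auto intro!: derivative_eq_intros holomorphic_derivI)
    moreover have "((\<lambda>x. h x * deriv (deriv h) x) has_field_derivative 0) (at z)"
      by (rule has_field_derivative_transform_within_open[where f = "\<lambda>_. 0" and S = S])
        (use S z eq in auto)
    ultimately have "h z * deriv (deriv (deriv h)) z + deriv h z * deriv (deriv h) z = 0"
      by (rule DERIV_unique)
    with True dh[OF z] show ?thesis by simp
  qed
  then have "deriv h constant_on S"
    using holomorphic_derivI[OF h'(1) S(1)] S
    by (intro has_field_derivative_0_imp_constant_on) metis+
  then obtain a where "\<And>z. z \<in> S \<Longrightarrow> deriv h z = a"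
    unfolding constant_on_def by blast
  then have "(h has_field_derivative a) (at z)" if "z \<in> S" for z
    using holomorphic_derivI[OF h S(1) that] that by simp
  from affine_if_deriv_constant[OF S this] that show thesis by metis
qed

text \<open>Formally \<open>(h^(1+c))'' = (1 + c) * h^(c-1) * (h * h'' + c * h'^2) = 0\<close>, so
  \<open>h^(1+c)\<close> is affine. Simple connectedness supplies a logarithm \<open>L\<close> of
  \<open>h\<close>, which gives these powers a meaning.\<close>

lemma affine_power_if_ode:
  assumes S: "open S" "simply_connected S" and h: "h holomorphic_on S"
    and hnz: "\<And>z. z \<in> S \<Longrightarrow> h z \<noteq> 0" and c: "1 + c \<noteq> 0"
    and eq: "\<And>z. z \<in> S \<Longrightarrow> h z * deriv (deriv h) z + c * (deriv h z)\<^sup>2 = 0"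
  obtains l a b where "l holomorphic_on S" "\<forall>z\<in>S. exp (l z) = a * z + b"
    "\<forall>z\<in>S. h z = exp (1 / (1 + c) * l z)"
proof -
  have conn: "connected S"
    using S(2) by (rule simply_connected_imp_connected)
  obtain L where L: "L holomorphic_on S" "\<And>z. z \<in> S \<Longrightarrow> h z = exp (L z)"
    using simply_connected_eq_holomorphic_log[OF S(1)] S(2) h hnz by metis
  have dh: "deriv h z = deriv L z * h z" if z: "z \<in> S" for z
  proof (rule DERIV_imp_deriv)
    have "((\<lambda>x. exp (L x)) has_field_derivative (deriv L z * h z)) (at z)"
      using holomorphic_derivI[OF L(1) S(1) z] z
      by (auto intro!: derivative_eq_intros simp: L(2))
    then show "(h has_field_derivative (deriv L z * h z)) (at z)"
      by (rule has_field_derivative_transform_within_open[where S = S]) (use S z L in auto)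
  qed
  \<comment> \<open>\<open>D\<close> is the derivative of
    \<open>h^(1+c) = exp ((1 + c) * L)\<close>, written with \<open>h'\<close> so that the equation
    for \<open>h\<close> applies to its own derivative.\<close>
  define D where "D z = (1 + c) * (deriv h z * exp (c * L z))" for z
  have "(D has_field_derivative 0) (at z)" if z: "z \<in> S" for z
  proof -
    have "deriv h holomorphic_on S"
      using h S(1) by (rule holomorphic_deriv)
    then have "(D has_field_derivative (1 + c) * (deriv (deriv h) z * exp (c * L z)
        + deriv h z * (exp (c * L z) * (c * deriv L z)))) (at z)"
      unfolding D_def using L(1) S(1) z
      by (auto intro!: derivative_eq_intros holomorphic_derivI)
    moreover have "h z * (deriv (deriv h) z + deriv h z * (c * deriv L z)) = 0"
      using eq[OF z] dh[OF z] by (simp add: algebra_simps power2_eq_square)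
    then have "deriv (deriv h) z + deriv h z * (c * deriv L z) = 0"
      using hnz[OF z] by simp
    then have "(1 + c) * (deriv (deriv h) z * exp (c * L z)
        + deriv h z * (exp (c * L z) * (c * deriv L z))) = 0"
      by algebra
    ultimately show ?thesis by simp
  qed
  then have "D constant_on S"
    using S(1) conn by (intro has_field_derivative_0_imp_constant_on)
  then obtain a where a: "\<And>z. z \<in> S \<Longrightarrow> D z = a"
    unfolding constant_on_def by blast
  have "((\<lambda>x. exp ((1 + c) * L x)) has_field_derivative a) (at z)" if z: "z \<in> S" for z
  proof -
    have "((\<lambda>x. exp ((1 + c) * L x)) has_field_derivative
        (exp ((1 + c) * L z) * ((1 + c) * deriv L z))) (at z)"
      using L(1) S(1) z by (auto intro!: derivative_eq_intros holomorphic_derivI)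
    moreover have "exp ((1 + c) * L z) * ((1 + c) * deriv L z) = D z"
      by (simp add: D_def dh[OF z] L(2)[OF z] exp_add algebra_simps)
    ultimately show ?thesis using a[OF z] by simp
  qed
  then obtain b where b: "\<And>z. z \<in> S \<Longrightarrow> exp ((1 + c) * L z) = a * z + b"
    by (rule affine_if_deriv_constant[OF S(1) conn]) blast+
  \<comment> \<open>The logarithm of \<open>a * z + b\<close> is \<open>(1 + c) * L\<close>;
    multiplied by \<open>1 / (1 + c)\<close> it returns \<open>L\<close>.\<close>
  show thesis
  proof (rule that[of "\<lambda>z. (1 + c) * L z" a b])
    show "(\<lambda>z. (1 + c) * L z) holomorphic_on S"
      by (intro holomorphic_intros L)
  qed (use b L(2) c in auto)
qed

theorem proposition1:
  fixes \<Omega> :: "complex set" and f h g :: "complex \<Rightarrow> complex"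
  assumes "complex_domain \<Omega>" and "simply_connected \<Omega>"
    and "sp_loc_univ_logharmonic \<Omega> f h g"
    and "\<forall>z\<in>\<Omega>. pre_Schwarzian h g z = 0"
  shows "\<exists>a b k :: complex. Re k > 1 / 2 \<and>
           is_affine_power \<Omega> a b k h \<and>
           (\<forall>z\<in>\<Omega>. dilatation h g z = (1 - k) / k)"
proof -
  have S: "open \<Omega>" "connected \<Omega>" "\<Omega> \<noteq> {}"
    using assms(1) by (auto simp: complex_domain_def)
  have h: "h holomorphic_on \<Omega>" and g: "g holomorphic_on \<Omega>"
    and dh: "\<And>z. z \<in> \<Omega> \<Longrightarrow> deriv h z \<noteq> 0" and gnz: "\<And>z. z \<in> \<Omega> \<Longrightarrow> g z \<noteq> 0"
    and less1: "\<And>z. z \<in> \<Omega> \<Longrightarrow> cmod (dilatation h g z) < 1"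
    using assms(3) by (auto simp: sp_loc_univ_logharmonic_def)
  define p where "p z = deriv (deriv h) z / deriv h z + deriv g z / g z" for z
  have hol_w: "dilatation h g holomorphic_on \<Omega>"
    unfolding dilatation_def[abs_def] using dh gnz
    by (intro holomorphic_intros h g S) auto
  have hol_p: "p holomorphic_on \<Omega>"
    unfolding p_def using dh gnz by (intro holomorphic_intros h g S) auto
  have rel: "p z = deriv (dilatation h g) z * cnj (dilatation h g z)
       / (1 - of_real ((cmod (dilatation h g z))\<^sup>2))" if z: "z \<in> \<Omega>" for z
  proof -
    \<comment> \<open>Both branches agree, so the middle term is holomorphic across the zeros of
      \<open>h\<close>.\<close>
    have middle: "(if h z = 0 then deriv g z / g z else dilatation h g z * (deriv h z / h z))
        = deriv g z / g z"
      using dh[OF z] by (simp add: dilatation_def)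
    have "pre_Schwarzian h g z = 0"
      using assms(4) z by blast
    then show ?thesis
      by (simp only: pre_Schwarzian_def p_def middle right_minus_eq)
  qed
  have const: "dilatation h g constant_on \<Omega>"
    using S(1,2) hol_w hol_p less1 rel by (rule constant_if_conjugate_relation(1))
  have p0: "p z = 0" if "z \<in> \<Omega>" for z
    using S(1,2) hol_w hol_p less1 rel that by (rule constant_if_conjugate_relation(2))
  obtain c where c: "\<And>z. z \<in> \<Omega> \<Longrightarrow> dilatation h g z = c"
    using const unfolding constant_on_def by blast
  have "cmod c < 1"
    using less1 c S(3) by force
  then have c1: "1 + c \<noteq> 0"
    by (metis add_eq_0_iff less_irrefl norm_minus_cancel norm_one)
  \<comment> \<open>Multiplying \<open>h'' * g + g' * h' = 0\<close> by \<open>h\<close> and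
    replacing \<open>g' * h\<close> by \<open>c * g * h'\<close> leaves the equation times
    \<open>g\<close>.\<close>
  have ode: "h z * deriv (deriv h) z + c * (deriv h z)\<^sup>2 = 0" if z: "z \<in> \<Omega>" for z
  proof -
    have "deriv g z * h z = c * (g z * deriv h z)"
      using c[OF z] dh[OF z] gnz[OF z] by (simp add: dilatation_def field_simps)
    moreover have "deriv (deriv h) z * g z + deriv g z * deriv h z = 0"
      using p0[OF z] dh[OF z] gnz[OF z] by (simp add: p_def field_simps)
    ultimately have "g z * (h z * deriv (deriv h) z + c * (deriv h z)\<^sup>2) = 0"
      by algebra
    with gnz[OF z] show ?thesis by simp
  qed
  define k where "k = 1 / (1 + c)"
  have k: "Re k > 1 / 2" "c = (1 - k) / k"
    using Re_inverse_gt_half[OF \<open>cmod c < 1\<close>] c1 by (auto simp: k_def field_simps)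
  have "\<exists>a b. is_affine_power \<Omega> a b k h"
  \<comment> \<open>Here \<open>c = 0\<close> means \<open>k = 1\<close>, the case in which
    \<open>h\<close> may vanish and no logarithm is required.\<close>
  proof (cases "c = 0")
    case True
    obtain a b where "\<And>z. z \<in> \<Omega> \<Longrightarrow> h z = a * z + b"
      using affine_if_mult_second_deriv_zero[OF S(1,2) h dh] ode True by auto
    then show ?thesis
      using True by (auto simp: is_affine_power_def k_def)
  next
    case False
    \<comment> \<open>At a zero of \<open>h\<close> the dilatation would be 0, not
      \<open>c\<close>.\<close>
    have hnz: "h z \<noteq> 0" if "z \<in> \<Omega>" for z
      using c[OF that] False by (auto simp: dilatation_def)
    obtain l a b where l: "l holomorphic_on \<Omega>" "\<forall>z\<in>\<Omega>. exp (l z) = a * z + b"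
      "\<forall>z\<in>\<Omega>. h z = exp (1 / (1 + c) * l z)"
      using S(1) assms(2) h hnz c1 ode by (rule affine_power_if_ode)
    have "a * z + b \<noteq> 0" if "z \<in> \<Omega>" for z
      using l(2) that by (metis exp_not_eq_zero)
    moreover have "k \<noteq> 1"
      using False c1 by (simp add: k_def)
    ultimately show ?thesis
      using l unfolding is_affine_power_def k_def by auto
  qed
  then show ?thesis
    using k c by blast
qed

end
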